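(* Let $n\ge 4$ and let $Q_n$ be the Cayley-Dickson loop. Then $\mathrm{Aut}(Q_n)\cong \mathrm{Aut}(Q_{n-1})\times \mathbb{Z}_2$, where $\mathbb{Z}_2$ is the cyclic group of order $2$.
   Context: Cayley-Dickson loops $Q_n$ are defined inductively, each with a negation $x\mapsto -x$ and a conjugation $x\mapsto x^*$. $Q_0=\{1,-1\}$ with the usual multiplication and $x^*=x$. For $n\ge 1$, $Q_n=\{(x,0),(x,1)\mid x\in Q_{n-1}\}$ with $-(x,a)=(-x,a)$, multiplication $(x,0)(y,0)=(xy,0)$, $(x,0)(y,1)=(yx,1)$, $(x,1)(y,0)=(xy^*,1)$, $(x,1)(y,1)=(-y^*x,0)$, and conjugation $(x,0)^*=(x^*,0)$, $(x,1)^*=(-x,1)$. The neutral element of $Q_n$ is $1=(1_{Q_{n-1}},0)$. An automorphism of a loop is a bijective homomorphism from the loop to itself; $\mathrm{Aut}(L)$ is the group of automorphisms of $L$ under composition. *)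

theory Defs
  imports "HOL-Algebra.Bij" "HOL-Algebra.Elementary_Groups"
begin

text \<open>
  All the loops live in one type: \<open>Base r\<close> is the element \<open>r\<close> of \<open>Q\<^sub>0 = {1, -1}\<close>, and \<open>In0 x\<close>, \<open>In1 x\<close>
  are the pairs \<open>(x,0)\<close>, \<open>(x,1)\<close>. The operations matter only on arguments of the same level.
\<close>

datatype cd = Base int | In0 cd | In1 cd

fun cd_neg :: "cd \<Rightarrow> cd" where
  "cd_neg (Base r) = Base (- r)"
| "cd_neg (In0 x) = In0 (cd_neg x)"
| "cd_neg (In1 x) = In1 (cd_neg x)"

fun cd_conj :: "cd \<Rightarrow> cd" where
  "cd_conj (Base r) = Base r"
| "cd_conj (In0 x) = In0 (cd_conj x)"
| "cd_conj (In1 x) = In1 (cd_neg x)"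

lemma size_cd_neg [simp]: "size (cd_neg x) = size x"
  by (induction x) auto

lemma size_cd_conj [simp]: "size (cd_conj x) = size x"
  by (induction x) auto

function (sequential) cd_mult :: "cd \<Rightarrow> cd \<Rightarrow> cd" where
  "cd_mult (Base r) (Base s) = Base (r * s)"
| "cd_mult (In0 x) (In0 y) = In0 (cd_mult x y)"
| "cd_mult (In0 x) (In1 y) = In1 (cd_mult y x)"
| "cd_mult (In1 x) (In0 y) = In1 (cd_mult x (cd_conj y))"
| "cd_mult (In1 x) (In1 y) = In0 (cd_neg (cd_mult (cd_conj y) x))"
| "cd_mult _ _ = undefined"
  by pat_completeness auto
termination by (relation "measure (\<lambda>(x, y). size x + size y)") auto

primrec cd_carrier :: "nat \<Rightarrow> cd set" where
  "cd_carrier 0 = {Base 1, Base (- 1)}"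
| "cd_carrier (Suc n) = In0 ` cd_carrier n \<union> In1 ` cd_carrier n"

primrec cd_one :: "nat \<Rightarrow> cd" where
  "cd_one 0 = Base 1"
| "cd_one (Suc n) = In0 (cd_one n)"

text \<open>
  The record type \<open>monoid\<close> only bundles the carrier, the product and the neutral element here;
  the product is not associative for \<open>n \<ge> 3\<close>. Likewise \<open>auto\<close> and \<open>AutoGroup\<close> do not require
  associativity: \<open>auto G\<close> consists of the bijective homomorphisms of \<open>G\<close> to itself.
\<close>

definition cd_loop :: "nat \<Rightarrow> cd monoid" where
  "cd_loop n = \<lparr>carrier = cd_carrier n, monoid.mult = cd_mult, one = cd_one n\<rparr>"

lemma cd_neg_closed: "x \<in> cd_carrier n \<Longrightarrow> cd_neg x \<in> cd_carrier n"
  by (induction n arbitrary: x) auto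

lemma cd_conj_closed: "x \<in> cd_carrier n \<Longrightarrow> cd_conj x \<in> cd_carrier n"
  by (induction n arbitrary: x) (auto simp: cd_neg_closed)

lemma cd_mult_closed:
  "x \<in> cd_carrier n \<Longrightarrow> y \<in> cd_carrier n \<Longrightarrow> cd_mult x y \<in> cd_carrier n"
  by (induction n arbitrary: x y) (auto simp: cd_neg_closed cd_conj_closed)

lemma cd_one_closed: "cd_one n \<in> cd_carrier n"
  by (induction n) auto

lemma cd_conj_one: "cd_conj (cd_one n) = cd_one n"
  by (induction n) auto

lemma cd_mult_one:
  "x \<in> cd_carrier n \<Longrightarrow> cd_mult (cd_one n) x = x \<and> cd_mult x (cd_one n) = x"
  by (induction n arbitrary: x) (auto simp: cd_conj_one)

lemma cd_neg_inject: "cd_neg x = cd_neg y \<longleftrightarrow> x = y"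
proof -
  have "cd_neg (cd_neg z) = z" for z
    by (induction z) auto
  then show ?thesis
    by metis
qed

lemma cd_conj_inject: "cd_conj x = cd_conj y \<longleftrightarrow> x = y"
proof -
  have neg: "cd_neg (cd_neg z) = z" for z
    by (induction z) auto
  have "cd_conj (cd_conj z) = z" for z
    by (induction z) (auto simp: neg)
  then show ?thesis
    by metis
qed

lemma cd_mult_cancel:
  assumes "x \<in> cd_carrier n" "y \<in> cd_carrier n" "z \<in> cd_carrier n"
  shows "(cd_mult x y = cd_mult x z \<longleftrightarrow> y = z) \<and> (cd_mult y x = cd_mult z x \<longleftrightarrow> y = z)"
  using assms
  by (induction n arbitrary: x y z) (auto simp: cd_neg_inject cd_conj_inject cd_conj_closed)

lemma finite_cd_carrier: "finite (cd_carrier n)"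
  by (induction n) auto

lemma cd_loop_divisions:
  assumes "a \<in> cd_carrier n"
  shows "bij_betw (cd_mult a) (cd_carrier n) (cd_carrier n)"
    and "bij_betw (\<lambda>x. cd_mult x a) (cd_carrier n) (cd_carrier n)"
proof -
  have "inj_on (cd_mult a) (cd_carrier n)" "inj_on (\<lambda>x. cd_mult x a) (cd_carrier n)"
    using assms cd_mult_cancel by (auto simp: inj_on_def)
  moreover have "cd_mult a ` cd_carrier n \<subseteq> cd_carrier n"
    "(\<lambda>x. cd_mult x a) ` cd_carrier n \<subseteq> cd_carrier n"
    using assms by (auto simp: cd_mult_closed)
  ultimately show "bij_betw (cd_mult a) (cd_carrier n) (cd_carrier n)"
    and "bij_betw (\<lambda>x. cd_mult x a) (cd_carrier n) (cd_carrier n)"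
    using endo_inj_surj[OF finite_cd_carrier] by (auto simp: bij_betw_def)
qed

end

theory Submission
  imports Defs
begin

text \<open>
  Modulo the sign, \<open>Q\<^sub>n\<close> is an elementary abelian group of order \<open>2\<^sup>n\<close>. The whole structure of the
  loop is therefore in the signs: independent elements anticommute, and an independent triple
  \<open>x, y, z\<close> either associates or satisfies \<open>(x y) z = - x (y z)\<close>. For an independent triple of
  \<open>Q\<^sub>n\<close> the doubling formulas give one rule (\<open>associates_level_pair\<close>): passing from \<open>a, b, c\<close> to
  \<open>(a,p), (b,q), (c,r)\<close> keeps the type of the triple if \<open>p = r\<close> and reverses it otherwise.

  Let \<open>e = (1,1)\<close> be the new generator of \<open>Q\<^sub>n\<close>, where \<open>n \<ge> 4\<close>. A direct computation shows that no
  independent triple with \<open>e\<close> in second or third place associates. The elements \<open>\<plusminus>e\<close> are the only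
  noncentral ones that never end an associating independent triple: for every other \<open>z = (c,r)\<close> there is an independent triple
  \<open>a, b, c\<close> in \<open>Q\<^sub>n\<^sub>-\<^sub>1\<close>, because \<open>n - 1 \<ge> 3\<close>, and by the rule one of \<open>(a,0), (b,0), z\<close> and
  \<open>(a,1), (b,0), z\<close> associates. Hence an automorphism \<open>\<phi>\<close> maps \<open>e\<close> to \<open>\<plusminus>e\<close>.

  It remains to see that \<open>\<phi>\<close> maps \<open>Q\<^sub>n\<^sub>-\<^sub>1 \<times> {0}\<close> to itself (\<open>even_index_iff\<close>). Let \<open>\<sigma> x\<close> tell whether
  \<open>\<phi>\<close> changes the second component of \<open>x\<close>; this is a homomorphism to \<open>Z\<^sub>2\<close>. Let \<open>f = (e',0)\<close>, where
  \<open>e'\<close> is the new generator of \<open>Q\<^sub>n\<^sub>-\<^sub>1\<close>. By the two facts above, a triple \<open>x, y, z\<close> that is independent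
  modulo \<open>e\<close> and has \<open>f\<close> or \<open>f e\<close> up to sign as \<open>y\<close> or \<open>z\<close> associates exactly if \<open>x\<close> and \<open>z\<close> have
  different second components. Applying this to \<open>x, y, f\<close> and to its image, with \<open>y\<close> chosen so that
  the image is covered too, gives \<open>\<sigma> x = \<sigma> f\<close> for all \<open>x\<close> outside a subgroup of order at most 4
  modulo \<open>e\<close>. As \<open>x f\<close> is then also outside, \<open>\<sigma> f = 0\<close>. So \<open>\<sigma>\<close> vanishes outside a
  proper subgroup, and therefore everywhere.

  So \<open>\<phi>\<close> is determined by its restriction \<open>\<alpha>\<close> to \<open>Q\<^sub>n\<^sub>-\<^sub>1\<close> and the sign of \<open>\<phi> e = \<plusminus>e\<close>. Conversely, all
  such pairs occur, since an automorphism of \<open>Q\<^sub>n\<^sub>-\<^sub>1\<close> preserves negation and conjugation. This is the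
  bijection \<open>extend_automorphism\<close>, and it is multiplicative.
\<close>

section \<open>Independent triples of bit vectors\<close>

unbundle bit_operations_syntax

lemma nat_xor_left_self [simp]: "a XOR (a XOR b) = b" for a b :: nat
  by (simp flip: xor.assoc)

lemma nat_xor_eq_0_iff [simp]: "a XOR b = 0 \<longleftrightarrow> a = b" for a b :: nat
  by (metis nat_xor_left_self xor.right_neutral xor_self_eq)

lemma nat_xor_pos_iff [simp]: "a XOR b > 0 \<longleftrightarrow> a \<noteq> b" for a b :: nat
  using nat_xor_eq_0_iff[of a b] by linarith

lemma nat_xor_eq_iff: "a XOR b = c \<longleftrightarrow> a = b XOR c" for a b c :: nat
  by (metis nat_xor_left_self xor.commute)

lemma nat_xor_div_2: "(a XOR b) div 2 = (a div 2) XOR (b div 2)" for a b :: nat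
  by (subst xor_rec) simp

text \<open>
  Natural numbers stand for vectors over the field with two elements, with \<open>XOR\<close> as addition. The
  predicate is linear independence.
\<close>

definition indep3 :: "nat \<Rightarrow> nat \<Rightarrow> nat \<Rightarrow> bool" where
  "indep3 a b c \<longleftrightarrow> a \<noteq> 0 \<and> b \<notin> {0, a} \<and> c \<notin> {0, a, b, a XOR b}"

text \<open>
  Dropping the lowest bit is linear, so it cannot make dependent vectors independent.
\<close>

lemma indep3_div_2: "indep3 (a div 2) (b div 2) (c div 2) \<Longrightarrow> indep3 a b c"
  unfolding indep3_def by (auto simp: nat_xor_div_2 intro!: Nat.gr0I)

lemma indep3_swap: "indep3 a b c \<longleftrightarrow> indep3 a c b"
  unfolding indep3_def by (auto simp: nat_xor_eq_iff xor.commute)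

lemma indep3_rotate: "indep3 a b c \<longleftrightarrow> indep3 b c a"
  unfolding indep3_def by (auto simp: ac_simps)

lemma indep3_neq:
  assumes "indep3 a b c"
  shows "a \<noteq> 0" "b \<noteq> 0" "c \<noteq> 0" "a \<noteq> b" "b \<noteq> a" "b \<noteq> c" "c \<noteq> b"
    "c \<noteq> a XOR b" "b XOR c \<noteq> a"
  using assms unfolding indep3_def by (auto simp: ac_simps)

text \<open>
  Three dimensions suffice to leave any subgroup of order 4; this is where \<open>n \<ge> 4\<close> is used.
\<close>

lemma nat_below_8_avoiding: "\<exists>k<8. k \<notin> {a, b, c, d}" for a b c d :: nat
proof (rule ccontr)
  assume "\<not> (\<exists>k<8. k \<notin> {a, b, c, d})"
  then have "{..<8} \<subseteq> set [a, b, c, d]"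
    by auto
  then have "card {..<8 :: nat} \<le> card (set [a, b, c, d])"
    by (intro card_mono) auto
  also have "\<dots> \<le> length [a, b, c, d]"
    by (rule card_length)
  finally show False
    by simp
qed

section \<open>The loop modulo signs\<close>

text \<open>
  The class of an element modulo signs, written as a bit vector. The lowest bit is the outermost
  second component, so parity tells the two halves of \<open>Q\<^sub>n\<close> apart and \<open>div 2\<close> is the class in
  \<open>Q\<^sub>n\<^sub>-\<^sub>1\<close>.
\<close>

primrec cd_index :: "cd \<Rightarrow> nat" where
  "cd_index (Base r) = 0"
| "cd_index (In0 x) = 2 * cd_index x"
| "cd_index (In1 x) = 2 * cd_index x + 1"

lemma cd_index_neg [simp]: "cd_index (cd_neg x) = cd_index x"
  by (induction x) auto

lemma cd_index_conj [simp]: "cd_index (cd_conj x) = cd_index x"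
  by (induction x) auto

lemma cd_index_mult:
  "x \<in> cd_carrier n \<Longrightarrow> y \<in> cd_carrier n \<Longrightarrow> cd_index (cd_mult x y) = cd_index x XOR cd_index y"
proof (induction n arbitrary: x y)
  case (Suc n)
  then show ?case
    by (auto simp: cd_conj_closed xor_rec[of "2 * _"] xor_rec[of "Suc (2 * _)"] xor.commute)
qed auto

lemma cd_index_one [simp]: "cd_index (cd_one n) = 0"
  by (induction n) auto

lemma ex_cd_index: "k < 2 ^ n \<Longrightarrow> \<exists>x\<in>cd_carrier n. cd_index x = k"
proof (induction n arbitrary: k)
  case (Suc n)
  have "k div 2 < 2 ^ n"
    using Suc.prems by auto
  then obtain x where x: "x \<in> cd_carrier n" "cd_index x = k div 2"
    using Suc.IH by blast
  show ?case
    by (cases "even k") (use x in \<open>auto intro: bexI[of _ "In0 x"] bexI[of _ "In1 x"]\<close>)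
qed auto

lemma cd_neg_neg [simp]: "cd_neg (cd_neg x) = x"
  by (induction x) auto

lemma cd_conj_neg: "cd_conj (cd_neg x) = cd_neg (cd_conj x)"
  by (induction x) auto

lemma cd_neg_neq: "x \<in> cd_carrier n \<Longrightarrow> cd_neg x \<noteq> x"
  by (induction n arbitrary: x) auto

lemma cd_mult_neg:
  assumes "x \<in> cd_carrier n" "y \<in> cd_carrier n"
  shows "cd_mult (cd_neg x) y = cd_neg (cd_mult x y)"
    and "cd_mult x (cd_neg y) = cd_neg (cd_mult x y)"
proof -
  have "cd_mult (cd_neg x) y = cd_neg (cd_mult x y) \<and> cd_mult x (cd_neg y) = cd_neg (cd_mult x y)"
    using assms by (induction n arbitrary: x y) (auto simp: cd_conj_neg cd_conj_closed)
  then show "cd_mult (cd_neg x) y = cd_neg (cd_mult x y)"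
    and "cd_mult x (cd_neg y) = cd_neg (cd_mult x y)"
    by simp_all
qed

lemma cd_index_eq_cases:
  assumes "x \<in> cd_carrier n" "y \<in> cd_carrier n" "cd_index x = cd_index y"
  shows "x = y \<or> x = cd_neg y"
  using assms
proof (induction n arbitrary: x y)
  case (Suc n)
  have *: "2 * a \<noteq> Suc (2 * b)" for a b
    by presburger
  show ?case
    using Suc.prems by (auto simp: * *[symmetric] dest: Suc.IH)
qed auto

lemma cd_conj_eq:
  "x \<in> cd_carrier n \<Longrightarrow> cd_conj x = (if cd_index x = 0 then x else cd_neg x)"
  by (induction n arbitrary: x) auto

lemma cd_mult_self:
  "x \<in> cd_carrier n \<Longrightarrow>
    cd_mult x x = (if cd_index x = 0 then cd_one n else cd_neg (cd_one n))"
proof (induction n arbitrary: x)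
  case (Suc n)
  then show ?case
    by (auto simp: cd_conj_eq cd_mult_neg split: if_splits)
qed auto

lemma cd_mult_central:
  assumes "x \<in> cd_carrier n" "y \<in> cd_carrier n" "cd_index x = 0"
  shows "cd_mult x y = cd_mult y x"
  using cd_index_eq_cases[OF assms(1) cd_one_closed] assms
  by (auto simp: cd_mult_one cd_mult_neg[OF cd_one_closed] cd_mult_neg(2)[OF _ cd_one_closed])

text \<open>
  In the doubling formulas two factors whose classes differ end up either in the same order, with
  one of them conjugated, or as a product of the previous level. In the case of two second halves
  one of the classes below may vanish, and then it is the conjugation of the other one that produces
  the sign.
\<close>

lemma cd_anticommute:
  assumes "x \<in> cd_carrier n" "y \<in> cd_carrier n"
    and "cd_index x \<noteq> 0" "cd_index y \<noteq> 0" "cd_index x \<noteq> cd_index y"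
  shows "cd_mult x y = cd_neg (cd_mult y x)"
  using assms
proof (induction n arbitrary: x y)
  case (Suc n)
  have In1: "cd_mult (In1 a) (In1 b) = cd_neg (cd_mult (In1 b) (In1 a))"
    if ab: "a \<in> cd_carrier n" "b \<in> cd_carrier n" "cd_index a \<noteq> cd_index b" for a b
  proof -
    consider "cd_index a = 0" "cd_index b \<noteq> 0" | "cd_index b = 0" "cd_index a \<noteq> 0"
      | "cd_index a \<noteq> 0" "cd_index b \<noteq> 0"
      using ab(3) by metis
    then show ?thesis
    proof cases
      case 1
      then show ?thesis
        using ab cd_mult_central[of a n b] by (simp add: cd_conj_eq[of _ n] cd_mult_neg[of _ n])
    next
      case 2
      then show ?thesis
        using ab cd_mult_central[of b n a] by (simp add: cd_conj_eq[of _ n] cd_mult_neg[of _ n])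
    next
      case 3
      then show ?thesis
        using ab Suc.IH[of a b] by (simp add: cd_conj_eq[of _ n] cd_mult_neg[of _ n])
    qed
  qed
  consider a b where "x = In0 a" "y = In0 b" "a \<in> cd_carrier n" "b \<in> cd_carrier n"
    | a b where "x = In0 a" "y = In1 b" "a \<in> cd_carrier n" "b \<in> cd_carrier n"
    | a b where "x = In1 a" "y = In0 b" "a \<in> cd_carrier n" "b \<in> cd_carrier n"
    | a b where "x = In1 a" "y = In1 b" "a \<in> cd_carrier n" "b \<in> cd_carrier n"
    using Suc.prems(1,2) by auto
  then show ?case
  proof cases
    case 1
    then show ?thesis
      using Suc.IH[of a b] Suc.prems(3-5) by simp
  next
    case 2
    then show ?thesis
      using Suc.prems(3-5) by (simp add: cd_conj_eq[of _ n] cd_mult_neg[of _ n])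
  next
    case 3
    then show ?thesis
      using Suc.prems(3-5) by (simp add: cd_conj_eq[of _ n] cd_mult_neg[of _ n])
  next
    case 4
    then show ?thesis
      using Suc.prems(5) In1[of a b] by (simp del: cd_mult.simps)
  qed
qed auto

section \<open>Associating triples\<close>

definition associates :: "cd \<Rightarrow> cd \<Rightarrow> cd \<Rightarrow> bool" where
  "associates x y z \<longleftrightarrow> cd_mult x (cd_mult y z) = cd_mult (cd_mult x y) z"

abbreviation level_pair :: "bool \<Rightarrow> cd \<Rightarrow> cd" where
  "level_pair p x \<equiv> (if p then In1 x else In0 x)"

text \<open>
  Both bracketings have the same class, so they can only differ by the sign.
\<close>

lemma not_associates:
  assumes "x \<in> cd_carrier n" "y \<in> cd_carrier n" "z \<in> cd_carrier n"
    and "\<not> associates x y z"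
  shows "cd_mult (cd_mult x y) z = cd_neg (cd_mult x (cd_mult y z))"
  using cd_index_eq_cases[of "cd_mult (cd_mult x y) z" n "cd_mult x (cd_mult y z)"] assms
  by (auto simp: associates_def cd_mult_closed cd_index_mult[of _ n] ac_simps)

lemma cd_carrier_SucE:
  assumes "x \<in> cd_carrier (Suc n)"
  obtains p a where "x = level_pair p a" "a \<in> cd_carrier n"
    "cd_index x = 2 * cd_index a + of_bool p"
  using assms that[of False] that[of True] by auto

text \<open>
  In each of the eight cases the two bracketings in \<open>Q\<^sub>n\<^sub>+\<^sub>1\<close> are products of \<open>a\<close>, \<open>b\<close>, \<open>c\<close> in
  some order, up to conjugations. By independence every conjugation and every exchange of two
  factors is a change of sign, so all these products reduce to \<open>\<plusminus>a (b c)\<close> and \<open>\<plusminus>(a b) c\<close>. Counting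
  signs, each of \<open>p\<close> and \<open>r\<close> contributes one change to the comparison.
\<close>

lemma associates_level_pair:
  assumes abc: "a \<in> cd_carrier n" "b \<in> cd_carrier n" "c \<in> cd_carrier n"
    and indep: "indep3 (cd_index a) (cd_index b) (cd_index c)"
  shows "associates (level_pair p a) (level_pair q b) (level_pair r c) \<longleftrightarrow>
    (p = r \<longleftrightarrow> associates a b c)"
proof -
  let ?x = "cd_mult a (cd_mult b c)"
  have conj: "cd_conj a = cd_neg a" "cd_conj b = cd_neg b" "cd_conj c = cd_neg c"
    "cd_conj (cd_mult b c) = cd_neg (cd_mult b c)"
    "cd_conj (cd_mult a b) = cd_neg (cd_mult a b)"
    using abc indep3_neq[OF indep]
    by (auto simp: cd_conj_eq[of _ n] cd_mult_closed cd_index_mult[of _ n])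
  have anti: "cd_mult b a = cd_neg (cd_mult a b)" "cd_mult c b = cd_neg (cd_mult b c)"
    "cd_mult (cd_mult b c) a = cd_neg ?x"
    "cd_mult c (cd_mult a b) = cd_neg (cd_mult (cd_mult a b) c)"
    using abc indep3_neq[OF indep]
    by (auto intro!: cd_anticommute[of _ n] simp: cd_mult_closed cd_index_mult[of _ n])
  have sign: "cd_mult (cd_mult a b) c = (if associates a b c then ?x else cd_neg ?x)"
    using not_associates[OF abc] by (auto simp: associates_def)
  have x: "cd_neg ?x \<noteq> ?x" "?x \<noteq> cd_neg ?x"
    using abc cd_neg_neq[of ?x n] by (auto simp: cd_mult_closed)
  note closed = abc cd_mult_closed[OF abc(1,2)] cd_mult_closed[OF abc(2,3)]
    cd_mult_closed[OF abc(1) cd_mult_closed[OF abc(2,3)]]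
  have neg:
    "cd_mult (cd_neg u) v = cd_neg (cd_mult u v)" "cd_mult u (cd_neg v) = cd_neg (cd_mult u v)"
    if "u \<in> cd_carrier n" "v \<in> cd_carrier n" for u v
    using that by (simp_all add: cd_mult_neg)
  note closed' = closed[THEN cd_neg_closed]
  show ?thesis
    unfolding associates_def[of "level_pair p a"]
    using x
    by (cases p; cases q; cases r;
        simp add: neg closed closed' conj anti cd_conj_neg; simp add: sign)
qed

text \<open>
  Multiplication by \<open>e = (1,1)\<close> moves a factor to the other half and leaves a product of the two
  remaining factors; in the two bracketings these factors occur in opposite orders, and so the signs
  differ.
\<close>

lemma top_generator_not_associates:
  assumes "x \<in> cd_carrier n" "y \<in> cd_carrier n" "e \<in> cd_carrier n" and e: "cd_index e = 1"
    and indep: "indep3 (cd_index x) (cd_index y) 1"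
  shows "\<not> associates x y e" and "\<not> associates x e y"
proof -
  obtain m where n: "n = Suc m"
    using assms by (cases n) auto
  obtain p a where x: "x = level_pair p a" "a \<in> cd_carrier m"
      "cd_index x = 2 * cd_index a + of_bool p"
    using assms(1) unfolding n by (rule cd_carrier_SucE)
  obtain q b where y: "y = level_pair q b" "b \<in> cd_carrier m"
      "cd_index y = 2 * cd_index b + of_bool q"
    using assms(2) unfolding n by (rule cd_carrier_SucE)
  obtain u where "e = In1 u" "u \<in> cd_carrier m" "cd_index u = 0"
    using assms n by auto
  then have e: "e = In1 (cd_one m) \<or> e = In1 (cd_neg (cd_one m))"
    using cd_index_eq_cases[of u m "cd_one m"] by (auto simp: cd_one_closed)
  have "cd_index x XOR cd_index y \<notin> {0, 1}"
    using indep by (auto simp: indep3_def)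
  then have "(cd_index x XOR cd_index y) div 2 \<noteq> 0"
    by (auto simp: div_eq_0_iff less_2_cases_iff)
  then have "cd_index a \<noteq> cd_index b"
    using x(3) y(3) by (auto simp: nat_xor_div_2)
  moreover have "cd_index a \<noteq> 0" "cd_index b \<noteq> 0"
    using indep x(3) y(3) by (auto simp: indep3_def split: if_splits)
  ultimately have ab: "cd_index a \<noteq> 0" "cd_index b \<noteq> 0" "cd_index a \<noteq> cd_index b"
    by simp_all
  have anti: "cd_mult b a = cd_neg (cd_mult a b)"
    using ab x y by (auto intro: cd_anticommute)
  have conj: "cd_conj a = cd_neg a" "cd_conj b = cd_neg b"
    "cd_conj (cd_mult a b) = cd_neg (cd_mult a b)"
    using ab x y by (auto simp: cd_conj_eq[of _ m] cd_mult_closed cd_index_mult[of _ m])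
  have neq: "cd_neg (cd_mult a b) \<noteq> cd_mult a b" "cd_mult a b \<noteq> cd_neg (cd_mult a b)"
    using cd_neg_neq[of "cd_mult a b" m] x y by (auto simp: cd_mult_closed)
  note simps = associates_def anti conj cd_mult_closed cd_neg_closed cd_one_closed cd_mult_neg[of _ m] cd_mult_one
    cd_conj_neg cd_conj_one cd_neg_inject
  show "\<not> associates x y e"
    using e neq x(1,2) y(1,2) by (cases p; cases q) (auto simp: simps)
  show "\<not> associates x e y"
    using e neq x(1,2) y(1,2) by (cases p; cases q) (auto simp: simps)
qed

text \<open>
  The converse of the preceding lemma: the class of \<open>e\<close> is the only nonzero class that never ends an
  associating independent triple. Moving the first entry to the other half changes the type of a
  triple, so one of two candidates associates.
\<close>

lemma ex_indep3_associates:
  assumes z: "z \<in> cd_carrier (Suc m)" and "m \<ge> 3" and "cd_index z \<notin> {0, 1}"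
  shows "\<exists>x\<in>cd_carrier (Suc m). \<exists>y\<in>cd_carrier (Suc m).
    indep3 (cd_index x) (cd_index y) (cd_index z) \<and> associates x y z"
proof -
  obtain r c where c: "z = level_pair r c" "c \<in> cd_carrier m" "cd_index z = 2 * cd_index c + of_bool r"
    using z by (rule cd_carrier_SucE)
  have ex: "\<exists>u\<in>cd_carrier m. cd_index u \<notin> {i, j, k, l}" for i j k l
  proof -
    obtain t where t: "t < 8" "t \<notin> {i, j, k, l}"
      using nat_below_8_avoiding[of i j k l] by blast
    moreover have "(8 :: nat) \<le> 2 ^ m"
      using power_increasing[OF \<open>m \<ge> 3\<close>, of "2 :: nat"] by simp
    ultimately show ?thesis
      using ex_cd_index[of t m] by force
  qed
  obtain a where a: "a \<in> cd_carrier m" "cd_index a \<notin> {0, cd_index c, 0, 0}"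
    using ex by blast
  obtain b where b: "b \<in> cd_carrier m"
      "cd_index b \<notin> {0, cd_index c, cd_index a, cd_index c XOR cd_index a}"
    using ex by blast
  have "cd_index c \<noteq> 0"
    using assms(3) c by auto
  with a b have indep: "indep3 (cd_index a) (cd_index b) (cd_index c)"
    by (auto simp: indep3_def nat_xor_eq_iff ac_simps)
  define p where "p = (associates a b c = r)"
  let ?x = "level_pair p a" and ?y = "In0 b"
  have "associates ?x ?y z"
    using associates_level_pair[OF a(1) b(1) c(2) indep, of p False r] c by (auto simp: p_def)
  moreover have "indep3 (cd_index ?x) (cd_index ?y) (cd_index z)"
    by (rule indep3_div_2) (use indep c(3) in simp)
  ultimately show ?thesis
    using a b by (intro bexI[of _ ?x] bexI[of _ ?y]) auto
qed

lemma indep3_iff_xor: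
  "indep3 a b c \<longleftrightarrow> a \<noteq> 0 \<and> b \<noteq> 0 \<and> c \<noteq> 0 \<and> a XOR b \<noteq> 0 \<and> a XOR c \<noteq> 0 \<and> b XOR c \<noteq> 0 \<and>
    (a XOR b) XOR c \<noteq> 0"
  unfolding indep3_def nat_xor_eq_0_iff by auto

text \<open>
  Here \<open>div 2\<close> passes to classes in the previous level, whose new generator has class 1. Triples that
  contain it do not associate there, so the type of the triple depends on the halves of its outer
  entries only.
\<close>

lemma associates_iff_parity:
  assumes xyz: "x \<in> cd_carrier (Suc m)" "y \<in> cd_carrier (Suc m)" "z \<in> cd_carrier (Suc m)"
    and indep: "indep3 (cd_index x div 2) (cd_index y div 2) (cd_index z div 2)"
    and top: "cd_index y div 2 = 1 \<or> cd_index z div 2 = 1"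
  shows "associates x y z \<longleftrightarrow> (even (cd_index x) \<longleftrightarrow> odd (cd_index z))"
proof -
  obtain p a where x: "x = level_pair p a" "a \<in> cd_carrier m" "cd_index x = 2 * cd_index a + of_bool p"
    using xyz(1) by (rule cd_carrier_SucE)
  obtain q b where y: "y = level_pair q b" "b \<in> cd_carrier m" "cd_index y = 2 * cd_index b + of_bool q"
    using xyz(2) by (rule cd_carrier_SucE)
  obtain r c where z: "z = level_pair r c" "c \<in> cd_carrier m" "cd_index z = 2 * cd_index c + of_bool r"
    using xyz(3) by (rule cd_carrier_SucE)
  have abc: "indep3 (cd_index a) (cd_index b) (cd_index c)"
    using indep x(3) y(3) z(3) by simp
  have "cd_index b = 1 \<or> cd_index c = 1"
    using top y(3) z(3) by simp
  then have "\<not> associates a b c"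
    using abc top_generator_not_associates[OF x(2) y(2) z(2)]
      top_generator_not_associates[OF x(2) z(2) y(2)] indep3_swap[of "cd_index a" 1 "cd_index c"]
    by auto
  then show ?thesis
    unfolding x(1) y(1) z(1) associates_level_pair[OF x(2) y(2) z(2) abc] by simp
qed

section \<open>Automorphisms\<close>

text \<open>Membership in \<open>cd_carrier (Suc m)\<close> is kept as an atomic condition from here on.\<close>

declare cd_carrier.simps(2) [simp del]

locale cd_automorphism =
  fixes n :: nat and \<phi> :: "cd \<Rightarrow> cd"
  assumes bij: "bij_betw \<phi> (cd_carrier n) (cd_carrier n)"
    and mult: "x \<in> cd_carrier n \<Longrightarrow> y \<in> cd_carrier n \<Longrightarrow> \<phi> (cd_mult x y) = cd_mult (\<phi> x) (\<phi> y)"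
begin

lemma closed [simp]: "x \<in> cd_carrier n \<Longrightarrow> \<phi> x \<in> cd_carrier n"
  using bij by (auto simp: bij_betw_def)

lemma inject: "x \<in> cd_carrier n \<Longrightarrow> y \<in> cd_carrier n \<Longrightarrow> \<phi> x = \<phi> y \<longleftrightarrow> x = y"
  using bij by (auto simp: bij_betw_def inj_on_def)

lemma surjE:
  assumes "y \<in> cd_carrier n"
  obtains x where "x \<in> cd_carrier n" "\<phi> x = y"
proof -
  have "y \<in> \<phi> ` cd_carrier n"
    using assms bij by (simp add: bij_betw_def)
  then show thesis
    using that by blast
qed

lemma one: "\<phi> (cd_one n) = cd_one n"
proof -
  have "cd_mult (\<phi> (cd_one n)) (\<phi> (cd_one n)) = cd_mult (\<phi> (cd_one n)) (cd_one n)"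
    using mult[of "cd_one n" "cd_one n"] by (simp add: cd_mult_one[of _ n] cd_one_closed)
  then show ?thesis
    using cd_mult_cancel[of "\<phi> (cd_one n)" n "\<phi> (cd_one n)" "cd_one n"] by (simp add: cd_one_closed)
qed

text \<open>
  The central elements \<open>\<plusminus>1\<close> are the ones with square 1.
\<close>

lemma index_eq_0_iff: "x \<in> cd_carrier n \<Longrightarrow> cd_index (\<phi> x) = 0 \<longleftrightarrow> cd_index x = 0"
proof -
  assume x: "x \<in> cd_carrier n"
  have square: "cd_mult y y = cd_one n \<longleftrightarrow> cd_index y = 0" if "y \<in> cd_carrier n" for y
    using cd_mult_self[OF that] cd_neg_neq[OF cd_one_closed[of n]] by auto
  have "cd_mult (\<phi> x) (\<phi> x) = cd_one n \<longleftrightarrow> cd_mult x x = cd_one n"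
    using x inject[of "cd_mult x x" "cd_one n"] by (simp add: mult one cd_mult_closed cd_one_closed)
  then show ?thesis
    using x by (simp add: square)
qed

lemma neg:
  assumes x: "x \<in> cd_carrier n"
  shows "\<phi> (cd_neg x) = cd_neg (\<phi> x)"
proof -
  have minus_one: "cd_neg (cd_one n) \<in> cd_carrier n"
    by (simp add: cd_neg_closed cd_one_closed)
  have "\<phi> (cd_neg (cd_one n)) \<noteq> cd_one n"
    using inject[OF minus_one cd_one_closed] cd_neg_neq[OF cd_one_closed[of n]] by (simp add: one)
  then have "\<phi> (cd_neg (cd_one n)) = cd_neg (cd_one n)"
    using cd_index_eq_cases[of "\<phi> (cd_neg (cd_one n))" n "cd_one n"] minus_one
      index_eq_0_iff[OF minus_one] by (simp add: cd_one_closed)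
  then have "\<phi> (cd_mult (cd_neg (cd_one n)) x) = cd_mult (cd_neg (cd_one n)) (\<phi> x)"
    using mult[OF minus_one x] by simp
  then show ?thesis
    using x by (simp add: cd_mult_neg[of _ n] cd_one_closed cd_mult_one)
qed

lemma associates_iff:
  "x \<in> cd_carrier n \<Longrightarrow> y \<in> cd_carrier n \<Longrightarrow> z \<in> cd_carrier n \<Longrightarrow>
    associates (\<phi> x) (\<phi> y) (\<phi> z) \<longleftrightarrow> associates x y z"
  unfolding associates_def
  using inject[of "cd_mult x (cd_mult y z)" "cd_mult (cd_mult x y) z"]
  by (simp add: mult cd_mult_closed)

text \<open>
  Independence says that certain products have nonzero class. So an automorphism preserves it for
  every class map \<open>g\<close> whose kernel it preserves. This is applied to the class in \<open>Q\<^sub>n\<close> and to the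
  class modulo \<open>e\<close>.
\<close>

lemma indep3_image_iff:
  assumes g_mult: "\<And>x y. x \<in> cd_carrier n \<Longrightarrow> y \<in> cd_carrier n \<Longrightarrow> g (cd_mult x y) = g x XOR g y"
    and g_eq_0: "\<And>x. x \<in> cd_carrier n \<Longrightarrow> g (\<phi> x) = 0 \<longleftrightarrow> g x = 0"
    and xyz: "x \<in> cd_carrier n" "y \<in> cd_carrier n" "z \<in> cd_carrier n"
  shows "indep3 (g (\<phi> x)) (g (\<phi> y)) (g (\<phi> z)) \<longleftrightarrow> indep3 (g x) (g y) (g z)"
proof -
  have xor: "g (\<phi> u) XOR g (\<phi> v) = 0 \<longleftrightarrow> g u XOR g v = 0"
    if "u \<in> cd_carrier n" "v \<in> cd_carrier n" for u v
    using g_eq_0[of "cd_mult u v"] that by (simp add: mult g_mult cd_mult_closed)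
  have "(g (\<phi> x) XOR g (\<phi> y)) XOR g (\<phi> z) = 0 \<longleftrightarrow> (g x XOR g y) XOR g z = 0"
    using xor[of "cd_mult x y" z] xyz by (simp only: mult g_mult cd_mult_closed closed)
  then show ?thesis
    using xyz by (simp only: indep3_iff_xor xor g_eq_0)
qed

end

text \<open>
  Automorphisms of \<open>Q\<^sub>n\<close> with \<open>n = m + 1 \<ge> 4\<close>.
\<close>

locale cd_automorphism_large = cd_automorphism "Suc m" \<phi> for m \<phi> +
  assumes m_ge_3: "m \<ge> 3"
begin

lemma index_top_generator:
  assumes e: "e \<in> cd_carrier (Suc m)" "cd_index e = 1"
  shows "cd_index (\<phi> e) = 1"
proof (rule ccontr)
  assume "cd_index (\<phi> e) \<noteq> 1"
  moreover have "cd_index (\<phi> e) \<noteq> 0"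
    using e index_eq_0_iff by simp
  ultimately obtain x' y' where "x' \<in> cd_carrier (Suc m)" "y' \<in> cd_carrier (Suc m)"
    and xy': "indep3 (cd_index x') (cd_index y') (cd_index (\<phi> e))" "associates x' y' (\<phi> e)"
    using ex_indep3_associates[of "\<phi> e" m] m_ge_3 e closed by auto
  then obtain x y where xy: "x \<in> cd_carrier (Suc m)" "\<phi> x = x'" "y \<in> cd_carrier (Suc m)" "\<phi> y = y'"
    by (metis surjE)
  have "indep3 (cd_index x) (cd_index y) 1"
    using xy' xy e indep3_image_iff[of cd_index x y e] by (simp add: cd_index_mult index_eq_0_iff)
  moreover have "associates x y e"
    using xy' xy e associates_iff[of x y e] by simp
  ultimately show False
    using top_generator_not_associates(1) xy e by blast
qed

text \<open>
  An automorphism fixes the class of \<open>e\<close>, so it acts on the classes modulo \<open>e\<close>.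
\<close>

lemma half_index_eq_0_iff:
  assumes x: "x \<in> cd_carrier (Suc m)"
  shows "cd_index (\<phi> x) div 2 = 0 \<longleftrightarrow> cd_index x div 2 = 0"
proof -
  have half: "k div 2 = 0 \<longleftrightarrow> k = 0 \<or> k = 1" for k :: nat
    by auto
  define e where "e = In1 (cd_one m)"
  have e: "e \<in> cd_carrier (Suc m)" "cd_index e = 1"
    by (auto simp: e_def cd_one_closed cd_carrier.simps)
  have "cd_index (\<phi> (cd_mult x e)) = 0 \<longleftrightarrow> cd_index (\<phi> x) = 1"
    using x e index_top_generator[OF e] by (simp add: mult cd_index_mult[of _ "Suc m"])
  moreover have "cd_index (cd_mult x e) = 0 \<longleftrightarrow> cd_index x = 1"
    using x e by (simp add: cd_index_mult[of _ "Suc m"])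
  ultimately have "cd_index (\<phi> x) = 1 \<longleftrightarrow> cd_index x = 1"
    using index_eq_0_iff[OF cd_mult_closed[OF x e(1)]] by argo
  then show ?thesis
    using index_eq_0_iff[OF x] by (simp add: half)
qed

lemma indep3_half_iff:
  assumes "x \<in> cd_carrier (Suc m)" "y \<in> cd_carrier (Suc m)" "z \<in> cd_carrier (Suc m)"
  shows "indep3 (cd_index (\<phi> x) div 2) (cd_index (\<phi> y) div 2) (cd_index (\<phi> z) div 2) \<longleftrightarrow>
    indep3 (cd_index x div 2) (cd_index y div 2) (cd_index z div 2)"
  using indep3_image_iff[of "\<lambda>x. cd_index x div 2" x y z] assms
  by (simp add: cd_index_mult[of _ "Suc m"] nat_xor_div_2 half_index_eq_0_iff)

lemma ex_half_index_avoiding: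
  "\<exists>x\<in>cd_carrier (Suc m). cd_index x div 2 \<notin> {a, b, c, d}"
proof -
  obtain t where t: "t < 8" "t \<notin> {a, b, c, d}"
    using nat_below_8_avoiding[of a b c d] by blast
  moreover have "(8 :: nat) \<le> 2 ^ m"
    using power_increasing[OF m_ge_3, of "2 :: nat"] by simp
  ultimately have "2 * t < 2 ^ Suc m"
    by simp
  then obtain x where "x \<in> cd_carrier (Suc m)" "cd_index x = 2 * t"
    using ex_cd_index by blast
  with t show ?thesis
    by (intro bexI[of _ x]) auto
qed

text \<open>
  An automorphism maps each of the two halves of \<open>Q\<^sub>n\<close> to itself. The argument with \<open>\<sigma>\<close> is the one
  outlined at the beginning.
\<close>

theorem even_index_iff:
  assumes "w \<in> cd_carrier (Suc m)"
  shows "even (cd_index (\<phi> w)) \<longleftrightarrow> even (cd_index w)"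
proof -
  let ?C = "cd_carrier (Suc m)"
  define h where "h x = cd_index x div 2" for x
  define \<sigma> where "\<sigma> x \<longleftrightarrow> (even (cd_index (\<phi> x)) \<noteq> even (cd_index x))" for x
  have h_mult: "h (cd_mult x y) = h x XOR h y" if "x \<in> ?C" "y \<in> ?C" for x y
    using that by (simp add: h_def cd_index_mult[of _ "Suc m"] nat_xor_div_2)
  have \<sigma>_mult: "\<sigma> (cd_mult x y) \<longleftrightarrow> (\<sigma> x \<noteq> \<sigma> y)" if "x \<in> ?C" "y \<in> ?C" for x y
    using that by (auto simp: \<sigma>_def mult cd_index_mult[of _ "Suc m"] even_xor_iff)
  have "2 < (2 :: nat) ^ Suc m"
    using power_strict_increasing[of 1 "Suc m" "2 :: nat"] m_ge_3 by simp
  then obtain f where f: "f \<in> ?C" "cd_index f = 2"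
    using ex_cd_index by blast
  \<comment> \<open>A triple with \<open>b\<close> in the middle has an image with \<open>f\<close> in the middle.\<close>
  obtain b where b: "b \<in> ?C" "\<phi> b = f"
    using f(1) by (rule surjE)
  define H where "H = {0, h f, h b, h f XOR h b}"
  have H: "i XOR j \<notin> H" if "i \<notin> H" "j \<in> H" for i j
    using that unfolding H_def by (auto simp: nat_xor_eq_iff ac_simps)
  have outside: "\<sigma> x = \<sigma> f" if x: "x \<in> ?C" "h x \<notin> H" for x
  proof -
    obtain y where y: "y \<in> ?C" "indep3 (h x) (h y) (h f)" "h (\<phi> y) = 1 \<or> h (\<phi> f) = 1"
      \<comment> \<open>If \<open>b\<close> and \<open>f\<close> agree modulo \<open>e\<close>, the last entry of the image is already good, and any
        independent \<open>y\<close> will do. Otherwise \<open>y = b\<close>.\<close>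
    proof (cases "h b = h f")
      case True
      obtain y where "y \<in> ?C" "h y \<notin> {0, h x, h f, h x XOR h f}"
        using ex_half_index_avoiding unfolding h_def by metis
      moreover have "h (\<phi> f) = 1"
      proof -
        have "h (\<phi> (cd_mult f b)) = 0"
          using half_index_eq_0_iff[of "cd_mult f b"] f b True h_mult[of f b]
          by (simp add: h_def cd_mult_closed)
        then show ?thesis
          using f b by (simp add: mult h_mult) (simp add: h_def)
      qed
      ultimately show ?thesis
        using x f that[of y] indep3_swap[of "h x" "h y" "h f"]
        by (auto simp: H_def indep3_def h_def)
    next
      case False
      have "h b \<noteq> 0"
        using half_index_eq_0_iff[OF b(1)] b f by (simp add: h_def)
      with False have "indep3 (h f) (h b) (h x)"
        using x f by (auto simp: H_def indep3_def h_def)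
      then have "indep3 (h x) (h b) (h f)"
        using indep3_rotate indep3_swap by blast
      then show ?thesis
        using b f that[of b] by (simp add: h_def)
    qed
    have "associates x y f \<longleftrightarrow> (even (cd_index x) \<longleftrightarrow> odd (cd_index f))"
      using associates_iff_parity[OF x(1) y(1) f(1)] y(2) f(2) by (simp add: h_def)
    moreover have "associates (\<phi> x) (\<phi> y) (\<phi> f) \<longleftrightarrow>
        (even (cd_index (\<phi> x)) \<longleftrightarrow> odd (cd_index (\<phi> f)))"
      using associates_iff_parity[of "\<phi> x" m "\<phi> y" "\<phi> f"] indep3_half_iff[OF x(1) y(1) f(1)] x y f
      by (simp add: h_def)
    ultimately show ?thesis
      using associates_iff[OF x(1) y(1) f(1)] by (auto simp: \<sigma>_def)
  qed
  \<comment> \<open>Multiplying by such an \<open>x\<close> moves elements with class in \<open>H\<close> to the outside.\<close>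
  obtain x where x: "x \<in> ?C" "h x \<notin> H"
    using ex_half_index_avoiding unfolding h_def H_def by metis
  have "\<not> \<sigma> f"
    using outside[of x] outside[of "cd_mult x f"] x f H[of "h x" "h f"]
    by (simp add: \<sigma>_mult h_mult cd_mult_closed H_def[THEN eqset_imp_iff, of "h f"])
  moreover have "\<sigma> w = \<sigma> f"
  proof (cases "h w \<in> H")
    case True
    then show ?thesis
      using outside[of x] outside[of "cd_mult x w"] x assms H[of "h x" "h w"] \<open>\<not> \<sigma> f\<close>
      by (simp add: \<sigma>_mult h_mult cd_mult_closed)
  qed (use outside assms in blast)
  ultimately show ?thesis
    by (simp add: \<sigma>_def)
qed

end

section \<open>Extending automorphisms to the next loop\<close>

lemma (in cd_automorphism) conj: "x \<in> cd_carrier n \<Longrightarrow> \<phi> (cd_conj x) = cd_conj (\<phi> x)"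
  by (simp add: cd_conj_eq[of _ n] index_eq_0_iff neg)

lemma cd_automorphismI:
  assumes closed: "\<And>x. x \<in> cd_carrier n \<Longrightarrow> \<phi> x \<in> cd_carrier n"
    and inj: "inj_on \<phi> (cd_carrier n)"
    and mult: "\<And>x y. x \<in> cd_carrier n \<Longrightarrow> y \<in> cd_carrier n \<Longrightarrow>
      \<phi> (cd_mult x y) = cd_mult (\<phi> x) (\<phi> y)"
  shows "cd_automorphism n \<phi>"
proof
  show "bij_betw \<phi> (cd_carrier n) (cd_carrier n)"
    using endo_inj_surj[OF finite_cd_carrier _ inj] inj closed by (auto simp: bij_betw_def)
qed (rule mult)

lemma cd_automorphism_compose:
  assumes "cd_automorphism n \<phi>" "cd_automorphism n \<psi>"
  shows "cd_automorphism n (compose (cd_carrier n) \<phi> \<psi>)"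
proof -
  interpret \<phi>: cd_automorphism n \<phi> by fact
  interpret \<psi>: cd_automorphism n \<psi> by fact
  show ?thesis
    by (rule cd_automorphismI)
      (auto simp: compose_def \<phi>.mult \<psi>.mult cd_mult_closed inj_on_def \<phi>.inject \<psi>.inject)
qed

lemma auto_cd_loop_iff:
  "\<phi> \<in> auto (cd_loop n) \<longleftrightarrow> \<phi> \<in> extensional (cd_carrier n) \<and> cd_automorphism n \<phi>"
  by (auto simp: auto_def cd_loop_def hom_def Bij_def cd_automorphism_def bij_betw_def)

lemma carrier_AutoGroup [simp]: "carrier (AutoGroup G) = auto G"
  by (simp add: AutoGroup_def)

lemma mult_AutoGroup:
  "\<phi> \<in> auto G \<Longrightarrow> \<psi> \<in> auto G \<Longrightarrow> \<phi> \<otimes>\<^bsub>AutoGroup G\<^esub> \<psi> = compose (carrier G) \<phi> \<psi>"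
  by (simp add: AutoGroup_def BijGroup_def auto_def)

text \<open>
  The extension of \<open>\<alpha>\<close> to the next loop that maps \<open>e\<close> to \<open>e\<close> if \<open>k = 0\<close> and to \<open>-e\<close> otherwise.
\<close>

definition extend_automorphism :: "nat \<Rightarrow> (cd \<Rightarrow> cd) \<Rightarrow> int \<Rightarrow> cd \<Rightarrow> cd" where
  "extend_automorphism m \<alpha> k = (\<lambda>x\<in>cd_carrier (Suc m). case x of
      Base r \<Rightarrow> Base r
    | In0 a \<Rightarrow> In0 (\<alpha> a)
    | In1 a \<Rightarrow> In1 (if k = 0 then \<alpha> a else cd_neg (\<alpha> a)))"

lemma extend_automorphism_simps:
  assumes "a \<in> cd_carrier m"
  shows "extend_automorphism m \<alpha> k (In0 a) = In0 (\<alpha> a)"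
    and "extend_automorphism m \<alpha> k (In1 a) = In1 (if k = 0 then \<alpha> a else cd_neg (\<alpha> a))"
  using assms by (auto simp: extend_automorphism_def cd_carrier.simps)

lemma cd_automorphism_extend:
  assumes "cd_automorphism m \<alpha>"
  shows "cd_automorphism (Suc m) (extend_automorphism m \<alpha> k)"
proof -
  interpret cd_automorphism m \<alpha> by fact
  show ?thesis
    by (rule cd_automorphismI)
      (auto simp: extend_automorphism_simps cd_carrier.simps inj_on_def inject cd_neg_inject mult conj
        neg cd_mult_closed cd_conj_closed cd_neg_closed cd_mult_neg[of _ m] cd_conj_neg split: if_splits)
qed

lemma extend_automorphism_in_auto:
  "\<alpha> \<in> auto (cd_loop m) \<Longrightarrow> extend_automorphism m \<alpha> k \<in> auto (cd_loop (Suc m))"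
  unfolding auto_cd_loop_iff
  by (simp add: cd_automorphism_extend) (simp add: extend_automorphism_def)

lemma extend_automorphism_compose:
  assumes "cd_automorphism m \<alpha>" "cd_automorphism m \<beta>" "k \<in> {0, 1}" "l \<in> {0, 1}"
  shows "extend_automorphism m (compose (cd_carrier m) \<alpha> \<beta>) ((k + l) mod 2) =
    compose (cd_carrier (Suc m)) (extend_automorphism m \<alpha> k) (extend_automorphism m \<beta> l)"
proof (rule ext)
  fix x
  interpret \<alpha>: cd_automorphism m \<alpha> by fact
  interpret \<beta>: cd_automorphism m \<beta> by fact
  show "extend_automorphism m (compose (cd_carrier m) \<alpha> \<beta>) ((k + l) mod 2) x =
    compose (cd_carrier (Suc m)) (extend_automorphism m \<alpha> k) (extend_automorphism m \<beta> l) x"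
  proof (cases "x \<in> cd_carrier (Suc m)")
    case True
    then show ?thesis
      using assms(3,4)
      by (auto simp: extend_automorphism_simps cd_carrier.simps compose_def \<alpha>.neg cd_neg_closed)
  qed (simp add: extend_automorphism_def compose_def)
qed

lemma extend_automorphism_inject:
  assumes "\<alpha> \<in> extensional (cd_carrier m)" "\<beta> \<in> extensional (cd_carrier m)"
    and "cd_automorphism m \<alpha>" "cd_automorphism m \<beta>" "k \<in> {0, 1}" "l \<in> {0, 1}"
    and eq: "extend_automorphism m \<alpha> k = extend_automorphism m \<beta> l"
  shows "\<alpha> = \<beta> \<and> k = l"
proof -
  interpret \<alpha>: cd_automorphism m \<alpha> by fact
  have "\<alpha> a = \<beta> a" if "a \<in> cd_carrier m" for a
    using fun_cong[OF eq, of "In0 a"] that by (simp add: extend_automorphism_simps)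
  then have "\<alpha> = \<beta>"
    using assms(1,2) by (rule extensionalityI[rotated 2])
  moreover have "cd_neg (\<alpha> (cd_one m)) \<noteq> \<alpha> (cd_one m)"
    using cd_neg_neq[of "\<alpha> (cd_one m)" m] by (simp add: cd_one_closed)
  then have "k = 0 \<longleftrightarrow> l = 0"
    using fun_cong[OF eq, of "In1 (cd_one m)"] \<open>\<alpha> = \<beta>\<close>
    by (auto simp: extend_automorphism_simps cd_one_closed split: if_splits)
  ultimately show ?thesis
    using assms(5,6) by auto
qed

text \<open>
  Since \<open>\<phi>\<close> preserves the first half, \<open>\<alpha>\<close> is its restriction; on the second half \<open>\<phi>\<close> is then forced
  by \<open>(a,1) = (a,0) e\<close>.
\<close>

lemma (in cd_automorphism_large) ex_extend_automorphism:
  assumes "\<phi> \<in> extensional (cd_carrier (Suc m))"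
  shows "\<exists>\<alpha> k. \<alpha> \<in> extensional (cd_carrier m) \<and> cd_automorphism m \<alpha> \<and> k \<in> {0, 1} \<and>
    \<phi> = extend_automorphism m \<alpha> k"
proof -
  have In0_closed: "In0 a \<in> cd_carrier (Suc m)" and In1_closed: "In1 a \<in> cd_carrier (Suc m)"
    if "a \<in> cd_carrier m" for a
    using that by (auto simp: cd_carrier.simps)
  have "\<exists>b\<in>cd_carrier m. \<phi> (In0 a) = In0 b" if "a \<in> cd_carrier m" for a
    using even_index_iff[OF In0_closed[OF that]] closed[OF In0_closed[OF that]]
    by (auto simp: cd_carrier.simps)
  then obtain \<alpha>' where \<alpha>': "\<And>a. a \<in> cd_carrier m \<Longrightarrow> \<alpha>' a \<in> cd_carrier m \<and> \<phi> (In0 a) = In0 (\<alpha>' a)"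
    by metis
  define \<alpha> where "\<alpha> = restrict \<alpha>' (cd_carrier m)"
  have \<alpha>: "\<alpha> a \<in> cd_carrier m" "\<phi> (In0 a) = In0 (\<alpha> a)" if "a \<in> cd_carrier m" for a
    using \<alpha>'[OF that] that by (simp_all add: \<alpha>_def)
  have auto_\<alpha>: "cd_automorphism m \<alpha>"
  proof (rule cd_automorphismI)
    show "inj_on \<alpha> (cd_carrier m)"
    proof (rule inj_onI)
      fix a b
      assume "a \<in> cd_carrier m" "b \<in> cd_carrier m" "\<alpha> a = \<alpha> b"
      then show "a = b"
        using inject[OF In0_closed In0_closed, of a b] by (simp add: \<alpha>)
    qed
    show "\<alpha> (cd_mult a b) = cd_mult (\<alpha> a) (\<alpha> b)" if "a \<in> cd_carrier m" "b \<in> cd_carrier m" for a b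
      using mult[OF In0_closed[OF that(1)] In0_closed[OF that(2)]] that by (simp add: \<alpha> cd_mult_closed)
  qed (rule \<alpha>)
  let ?e = "In1 (cd_one m)"
  have e: "?e \<in> cd_carrier (Suc m)"
    using In1_closed cd_one_closed by blast
  have "cd_index (\<phi> ?e) = cd_index ?e"
    using index_top_generator[OF e] by simp
  then have "\<phi> ?e = ?e \<or> \<phi> ?e = cd_neg ?e"
    by (rule cd_index_eq_cases[OF closed[OF e] e])
  then obtain k :: int where k: "k \<in> {0, 1}" "\<phi> ?e = (if k = 0 then ?e else cd_neg ?e)"
    by (metis insertCI zero_neq_one)
  have In1: "\<phi> (In1 a) = In1 (if k = 0 then \<alpha> a else cd_neg (\<alpha> a))" if a: "a \<in> cd_carrier m" for a
  proof -
    have "\<phi> (In1 a) = \<phi> (cd_mult (In0 a) ?e)"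
      using a by (simp add: cd_mult_one)
    also have "\<dots> = cd_mult (In0 (\<alpha> a)) (\<phi> ?e)"
      using mult[OF In0_closed[OF a] e] a by (simp add: \<alpha>)
    also have "\<dots> = In1 (if k = 0 then \<alpha> a else cd_neg (\<alpha> a))"
      using \<alpha>(1)[OF a] by (simp add: k(2) cd_mult_one cd_mult_neg[OF cd_one_closed])
    finally show ?thesis .
  qed
  have "\<phi> x = extend_automorphism m \<alpha> k x" if "x \<in> cd_carrier (Suc m)" for x
    using that by (auto simp: cd_carrier.simps extend_automorphism_simps \<alpha> In1)
  then have "\<phi> = extend_automorphism m \<alpha> k"
    using assms by (intro extensionalityI[of _ "cd_carrier (Suc m)"]) (auto simp: extend_automorphism_def)
  then show ?thesis
    using auto_\<alpha> k(1) by (auto simp: \<alpha>_def)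
qed

text \<open>
  A multiplicative bijection can be inverted as soon as the source is closed under its
  multiplication. This avoids showing that the automorphisms of a nonassociative loop form a group,
  which the symmetry of \<open>\<cong>\<close> for groups would require.
\<close>

lemma is_iso_sym_of_closed:
  assumes h: "h \<in> iso G H"
    and closed: "\<And>x y. x \<in> carrier G \<Longrightarrow> y \<in> carrier G \<Longrightarrow> x \<otimes>\<^bsub>G\<^esub> y \<in> carrier G"
  shows "H \<cong> G"
proof -
  let ?g = "inv_into (carrier G) h"
  have bij: "bij_betw h (carrier G) (carrier H)" and hom: "h \<in> hom G H"
    using h by (auto simp: iso_def)
  have g: "?g y \<in> carrier G" "h (?g y) = y" if "y \<in> carrier H" for y
    using bij that by (auto simp: bij_betw_def inv_into_into f_inv_into_f)
  have "?g (x \<otimes>\<^bsub>H\<^esub> y) = ?g x \<otimes>\<^bsub>G\<^esub> ?g y" if xy: "x \<in> carrier H" "y \<in> carrier H" for x y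
  proof -
    have "h (?g x \<otimes>\<^bsub>G\<^esub> ?g y) = x \<otimes>\<^bsub>H\<^esub> y"
      using hom_mult[OF hom g(1)[OF xy(1)] g(1)[OF xy(2)]] g(2) xy by simp
    then show ?thesis
      using inv_into_f_f[OF bij_betw_imp_inj_on[OF bij] closed[OF g(1)[OF xy(1)] g(1)[OF xy(2)]]]
      by simp
  qed
  then have "?g \<in> hom H G"
    using g by (auto simp: hom_def)
  then show ?thesis
    using bij_betw_inv_into[OF bij] by (auto simp: is_iso_def iso_def)
qed

theorem theorem41:
  fixes n :: nat
  assumes "n \<ge> 4"
  shows "AutoGroup (cd_loop n) \<cong> AutoGroup (cd_loop (n - 1)) \<times>\<times> integer_mod_group 2"
proof -
  obtain m where n: "n = Suc m" and m: "m \<ge> 3"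
    using assms by (cases n) auto
  let ?A = "AutoGroup (cd_loop m)" and ?Z = "integer_mod_group 2"
  let ?h = "\<lambda>(\<alpha>, k). extend_automorphism m \<alpha> k"
  have carrier_Z: "carrier ?Z = {0, 1}"
    by (auto simp: carrier_integer_mod_group)
  have carrier_loop: "carrier (cd_loop l) = cd_carrier l" for l
    by (simp add: cd_loop_def)
  have "?h \<in> iso (?A \<times>\<times> ?Z) (AutoGroup (cd_loop (Suc m)))"
    unfolding iso_def
  proof (rule CollectI, rule conjI)
    show "?h \<in> hom (?A \<times>\<times> ?Z) (AutoGroup (cd_loop (Suc m)))"
    proof (rule homI)
      fix p
      assume "p \<in> carrier (?A \<times>\<times> ?Z)"
      then show "?h p \<in> carrier (AutoGroup (cd_loop (Suc m)))"
        by (auto simp: extend_automorphism_in_auto)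
    next
      fix p q
      assume pq: "p \<in> carrier (?A \<times>\<times> ?Z)" "q \<in> carrier (?A \<times>\<times> ?Z)"
      then obtain \<alpha> k \<beta> l where "p = (\<alpha>, k)" "q = (\<beta>, l)" "\<alpha> \<in> auto (cd_loop m)"
        "\<beta> \<in> auto (cd_loop m)" "k \<in> {0, 1}" "l \<in> {0, 1}"
        by (auto simp: carrier_Z)
      then show "?h (p \<otimes>\<^bsub>?A \<times>\<times> ?Z\<^esub> q) = ?h p \<otimes>\<^bsub>AutoGroup (cd_loop (Suc m))\<^esub> ?h q"
        using extend_automorphism_compose[of m \<alpha> \<beta> k l]
        by (simp add: mult_AutoGroup carrier_loop extend_automorphism_in_auto)
          (simp add: auto_cd_loop_iff)
    qed
    show "bij_betw ?h (carrier (?A \<times>\<times> ?Z)) (carrier (AutoGroup (cd_loop (Suc m))))"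
      unfolding bij_betw_def
    proof (intro conjI equalityI subsetI)
      show "inj_on ?h (carrier (?A \<times>\<times> ?Z))"
      proof (rule inj_onI)
        fix p q
        assume pq: "p \<in> carrier (?A \<times>\<times> ?Z)" "q \<in> carrier (?A \<times>\<times> ?Z)" "?h p = ?h q"
        then obtain \<alpha> k \<beta> l where "p = (\<alpha>, k)" "q = (\<beta>, l)" "\<alpha> \<in> auto (cd_loop m)"
          "\<beta> \<in> auto (cd_loop m)" "k \<in> {0, 1}" "l \<in> {0, 1}"
          by (auto simp: carrier_Z)
        then show "p = q"
          using extend_automorphism_inject[of \<alpha> m \<beta> k l] pq(3) by (simp add: auto_cd_loop_iff)
      qed
    next
      fix \<phi>
      assume "\<phi> \<in> ?h ` carrier (?A \<times>\<times> ?Z)"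
      then show "\<phi> \<in> carrier (AutoGroup (cd_loop (Suc m)))"
        by (auto simp: extend_automorphism_in_auto)
    next
      fix \<phi>
      assume "\<phi> \<in> carrier (AutoGroup (cd_loop (Suc m)))"
      then have \<phi>: "\<phi> \<in> extensional (cd_carrier (Suc m))" "cd_automorphism (Suc m) \<phi>"
        by (auto simp: auto_cd_loop_iff)
      then interpret cd_automorphism_large m \<phi>
        using m by (simp add: cd_automorphism_large_def cd_automorphism_large_axioms_def)
      show "\<phi> \<in> ?h ` carrier (?A \<times>\<times> ?Z)"
        using ex_extend_automorphism[OF \<phi>(1)]
        by (fastforce simp: carrier_Z auto_cd_loop_iff image_iff)
    qed
  qed
  moreover have "p \<otimes>\<^bsub>?A \<times>\<times> ?Z\<^esub> q \<in> carrier (?A \<times>\<times> ?Z)"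
    if "p \<in> carrier (?A \<times>\<times> ?Z)" "q \<in> carrier (?A \<times>\<times> ?Z)" for p q
    using that
    by (auto simp: carrier_Z mult_AutoGroup carrier_loop auto_cd_loop_iff[of _ m]
        cd_automorphism_compose)
  ultimately show ?thesis
    unfolding n diff_Suc_1 by (rule is_iso_sym_of_closed)
qed

end
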